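(* Let $n = p_1^{k_1} p_2^{k_2} \cdots p_r^{k_r}$ be the prime factorization of a positive integer $n$, with distinct primes $p_i$ and integers $k_i \ge 1$, and let $D = \prod_{i=1}^r (k_i+1)$ be the number of divisors of $n$. Then the First and Second Zagreb indices of the divisor prime graph $G_{Dp(n)}$ are $$M_1(G_{Dp(n)}) = \prod_{i=1}^r \left( (k_i+1)^2 + k_i \right) - 2D + 1,$$ $$M_2(G_{Dp(n)}) = \frac{1}{2}\left[ D\prod_{i=1}^r (3k_i+1) - 2\prod_{i=1}^r (2k_i+1) - D^2 + 2D \right].$$
   Context: For a positive integer $n$, the divisor prime graph $G_{Dp(n)}$ is the simple graph whose vertex set is the set of positive divisors of $n$, in which two distinct vertices $x, y$ are adjacent if and only if $\gcd(x,y) = 1$ (no loops). For a graph $G$ with degree function $d(\cdot)$ and edge set $E$, the First Zagreb index is $M_1(G) = \sum_{v \in V(G)} d(v)^2$ and the Second Zagreb index is $M_2(G) = \sum_{uv \in E} d(u)d(v)$. *)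

theory Defs
  imports Complex_Main "HOL-Computational_Algebra.Primes"
begin

text \<open>An undirected graph is given by its vertices and its edges, an edge being the set of its
  two endpoints.\<close>

record 'a ugraph =
  verts :: "'a set"
  edges :: "'a set set"

definition finite_simple_graph :: "'a ugraph \<Rightarrow> bool" where
  "finite_simple_graph G \<longleftrightarrow>
     finite (verts G) \<and> (\<forall>e \<in> edges G. e \<subseteq> verts G \<and> card e = 2)"

definition degree :: "'a ugraph \<Rightarrow> 'a \<Rightarrow> nat" where
  "degree G v = card {e \<in> edges G. v \<in> e}"

definition first_zagreb :: "'a ugraph \<Rightarrow> nat" where
  "first_zagreb G = (\<Sum>v \<in> verts G. (degree G v)\<^sup>2)"

text \<open>In a simple graph the inner product below has exactly two factors, so it is the product of
  the degrees of the two endpoints; every undirected edge is counted once.\<close>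

definition second_zagreb :: "'a ugraph \<Rightarrow> nat" where
  "second_zagreb G = (\<Sum>e \<in> edges G. \<Prod>v \<in> e. degree G v)"

definition divisor_prime_graph :: "nat \<Rightarrow> nat ugraph" where
  "divisor_prime_graph n =
     \<lparr> verts = {d. d dvd n},
       edges = {{x, y} | x y. x dvd n \<and> y dvd n \<and> x \<noteq> y \<and> gcd x y = 1} \<rparr>"

lemma finite_simple_graph_divisor_prime_graph:
  assumes "n > 0"
  shows "finite_simple_graph (divisor_prime_graph n)"
  using assms by (auto simp: finite_simple_graph_def divisor_prime_graph_def)

end

theory Submission
  imports Defs
begin

text \<open>Let \<open>c(d)\<close> be the number of divisors of \<open>n\<close> coprime to \<open>d\<close>. Only \<open>1\<close> is coprime to itself, so the
  degree of \<open>d\<close> is \<open>c(d) - [d = 1]\<close>. Hence both indices reduce to the three sums of \<open>c(d)\<close>, of \<open>c(d)\<^sup>2\<close>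
  and of \<open>c(x) c(y)\<close> over coprime ordered pairs of divisors of \<open>n\<close>. All three are multiplicative in \<open>n\<close>, and
  at \<open>p\<^sup>k\<close>, where \<open>c(1) = k + 1\<close> and \<open>c(p\<^sup>j) = 1\<close> for \<open>j \<ge> 1\<close>, they take the values \<open>2k + 1\<close>,
  \<open>(k + 1)\<^sup>2 + k\<close> and \<open>(k + 1)\<^sup>2 + 2k(k + 1) = (k + 1)(3k + 1)\<close>.\<close>

subsection \<open>Sums over divisors\<close>

text \<open>The inverse map is \<open>d\<close> to \<open>(gcd d a, gcd d b)\<close>: a divisor
  \<open>y\<close> of \<open>b\<close> shares no factor with \<open>a\<close>, so
  \<open>gcd (x * y) a\<close> recovers \<open>x\<close>, and symmetrically for
  \<open>y\<close>.\<close>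

lemma bij_betw_divisors_mult:
  fixes a b :: nat
  assumes "coprime a b"
  shows "bij_betw (\<lambda>(x, y). x * y) ({d. d dvd a} \<times> {d. d dvd b}) {d. d dvd a * b}"
proof (rule bij_betw_imageI)
  have gcd_a: "gcd (x * y) a = x" and gcd_b: "gcd (x * y) b = y" if "x dvd a" "y dvd b" for x y
  proof -
    have "coprime a y" "coprime b x"
      using assms that by (meson coprime_divisors dvd_refl coprime_commute)+
    then show "gcd (x * y) a = x" "gcd (x * y) b = y"
      using that by (simp_all add: gcd_mult_left_right_cancel gcd_mult_left_left_cancel
          coprime_commute gcd_proj1_iff)
  qed
  show "inj_on (\<lambda>(x, y). x * y) ({d. d dvd a} \<times> {d. d dvd b})"
    by (rule inj_onI, clarsimp) (metis gcd_a gcd_b)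
  show "(\<lambda>(x, y). x * y) ` ({d. d dvd a} \<times> {d. d dvd b}) = {d. d dvd a * b}"
    by (auto intro: mult_dvd_mono elim!: dvd_productE)
qed

lemma sum_divisors_mult:
  fixes a b :: nat
  assumes "coprime a b"
  shows "(\<Sum>d | d dvd a * b. f d) = (\<Sum>x | x dvd a. \<Sum>y | y dvd b. f (x * y))"
  using sum.reindex_bij_betw[OF bij_betw_divisors_mult[OF assms], of f]
  by (simp add: sum.cartesian_product case_prod_unfold)

text \<open>The divisor 1 is split off because coprimality treats it differently from every
  \<open>p ^ j\<close> with \<open>j \<ge> 1\<close>.\<close>

lemma sum_divisors_prime_power:
  fixes p :: nat
  assumes "prime p"
  shows "(\<Sum>d | d dvd p ^ k. f d) = f 1 + (\<Sum>j = 1..k. f (p ^ j))"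
proof -
  have "{d. d dvd p ^ k} = (\<lambda>j. p ^ j) ` {0..k}"
    using assms by (auto simp: divides_primepow_nat)
  moreover have "inj_on (\<lambda>j. p ^ j) {0..k}"
    using prime_gt_1_nat[OF assms] by (auto intro: inj_onI)
  ultimately have "(\<Sum>d | d dvd p ^ k. f d) = (\<Sum>j = 0..k. f (p ^ j))"
    by (simp add: sum.reindex)
  then show ?thesis
    by (simp add: sum.atLeast_Suc_atMost)
qed

text \<open>Reduces each divisor sum to its values at prime powers. The hypothesis
  \<open>F 1 = 1\<close> covers the empty product.\<close>

lemma multiplicative_prod_prime_powers:
  fixes F :: "nat \<Rightarrow> 'b::comm_monoid_mult" and p :: "'i \<Rightarrow> nat"
  assumes one: "F 1 = 1"
    and mult: "\<And>a b. coprime a b \<Longrightarrow> F (a * b) = F a * F b"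
    and "finite I" "inj_on p I" "\<And>i. i \<in> I \<Longrightarrow> prime (p i)"
  shows "F (\<Prod>i\<in>I. p i ^ k i) = (\<Prod>i\<in>I. F (p i ^ k i))"
  using assms(3-5)
proof (induction I rule: finite_induct)
  case empty
  then show ?case using one by simp
next
  case (insert i I)
  have "coprime (p i ^ k i) (\<Prod>j\<in>I. p j ^ k j)"
  proof (rule prod_coprime_right)
    fix j assume "j \<in> I"
    then have "p i \<noteq> p j" using insert by (auto simp: inj_on_def)
    then show "coprime (p i ^ k i) (p j ^ k j)"
      using insert.prems \<open>j \<in> I\<close> by (simp add: primes_coprime)
  qed
  then show ?case using insert by (simp add: mult)
qed

text \<open>The cross pairs \<open>x, y'\<close> and \<open>y, x'\<close> are coprime automatically,
  since they divide the coprime numbers \<open>a\<close> and \<open>b\<close>. Hence the indicator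
  of coprimality factors, which makes the sums below multiplicative.\<close>

lemma coprime_mult_divisors_iff:
  fixes a b :: nat
  assumes "coprime a b" "x dvd a" "x' dvd a" "y dvd b" "y' dvd b"
  shows "coprime (x * y) (x' * y') \<longleftrightarrow> coprime x x' \<and> coprime y y'"
proof -
  have "coprime x y'" "coprime y x'"
    using assms by (meson coprime_divisors coprime_commute)+
  then show ?thesis by auto
qed

subsection \<open>Coprime divisors\<close>

text \<open>A sum of indicators rather than a cardinality, so that the product rule for divisor sums
  applies; real-valued, so that subtraction is not truncated.\<close>

definition coprime_count :: "nat \<Rightarrow> nat \<Rightarrow> real" where
  "coprime_count n d = (\<Sum>y | y dvd n. of_bool (coprime d y))"

lemma coprime_count_eq_card:
  assumes "n > 0"
  shows "coprime_count n d = real (card {y. y dvd n \<and> coprime d y})"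
  using assms by (simp add: coprime_count_def sum.If_cases of_bool_def Collect_conj_eq)

lemma coprime_count_mult:
  assumes "coprime a b" "x dvd a" "y dvd b"
  shows "coprime_count (a * b) (x * y) = coprime_count a x * coprime_count b y"
  unfolding coprime_count_def sum_divisors_mult[OF assms(1)] sum_product
  by (intro sum.cong refl) (use assms in \<open>auto simp: coprime_mult_divisors_iff
      simp del: coprime_mult_left_iff coprime_mult_right_iff\<close>)

lemma coprime_count_prime_power:
  assumes "prime p"
  shows "coprime_count (p ^ k) 1 = real k + 1"
    and "j \<ge> 1 \<Longrightarrow> coprime_count (p ^ k) (p ^ j) = 1"
proof -
  show "coprime_count (p ^ k) 1 = real k + 1"
    unfolding coprime_count_def sum_divisors_prime_power[OF assms] by simp
  \<comment> \<open>For \<open>j \<ge> 1\<close> this leaves only the term of the divisor 1.\<close>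
  have "\<not> coprime p p" using assms by auto
  then show "coprime_count (p ^ k) (p ^ j) = 1" if "j \<ge> 1"
    unfolding coprime_count_def sum_divisors_prime_power[OF assms] using that by simp
qed

lemma coprime_count_1: "coprime_count n 1 = real (card {d. d dvd n})"
  by (simp add: coprime_count_def)

text \<open>The exponent is general to serve three uses: \<open>m = 0\<close> counts divisors,
  \<open>m = 1\<close> gives the linear term of the second index, \<open>m = 2\<close> the main term
  of the first.\<close>

lemma sum_coprime_count_power_mult:
  assumes "coprime a b"
  shows "(\<Sum>d | d dvd a * b. coprime_count (a * b) d ^ m) =
    (\<Sum>d | d dvd a. coprime_count a d ^ m) * (\<Sum>d | d dvd b. coprime_count b d ^ m)"
  unfolding sum_divisors_mult[OF assms] sum_product
  by (intro sum.cong refl) (use assms in \<open>auto simp: coprime_count_mult power_mult_distrib\<close>)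

lemma sum_coprime_count_power_prime_power:
  assumes "prime p"
  shows "(\<Sum>d | d dvd p ^ k. coprime_count (p ^ k) d ^ m) = (real k + 1) ^ m + real k"
  unfolding sum_divisors_prime_power[OF assms] using assms
  by (simp add: coprime_count_prime_power[simplified])

text \<open>The pair \<open>(1, 1)\<close>, which is not an edge, is kept so that the sum is
  multiplicative.\<close>

definition coprime_pair_sum :: "nat \<Rightarrow> real" where
  "coprime_pair_sum n = (\<Sum>x | x dvd n. \<Sum>y | y dvd n.
     of_bool (coprime x y) * (coprime_count n x * coprime_count n y))"

lemma coprime_pair_sum_mult:
  assumes "coprime a b"
  shows "coprime_pair_sum (a * b) = coprime_pair_sum a * coprime_pair_sum b"
  unfolding coprime_pair_sum_def sum_divisors_mult[OF assms] sum_product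
  by (intro sum.cong refl)
     (use assms in \<open>auto simp: coprime_count_mult coprime_mult_divisors_iff
      simp del: coprime_mult_left_iff coprime_mult_right_iff\<close>)

lemma coprime_pair_sum_prime_power:
  assumes "prime p"
  shows "coprime_pair_sum (p ^ k) = (real k + 1) * (3 * real k + 1)"
proof -
  \<comment> \<open>Only pairs containing a 1 survive: \<open>(1, 1)\<close> contributes
    \<open>(k + 1)\<^sup>2\<close> and the other \<open>2k\<close> pairs contribute
    \<open>k + 1\<close> each.\<close>
  have "\<not> coprime p p" using assms by auto
  then show ?thesis
    unfolding coprime_pair_sum_def sum_divisors_prime_power[OF assms] using assms
    by (simp add: coprime_count_prime_power[simplified] algebra_simps)
qed

subsection \<open>Zagreb indices of the divisor prime graph\<close>

text \<open>Every edge has exactly two preimages, \<open>(x, y)\<close> and \<open>(y, x)\<close>;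
  this is the source of the factor 1/2 in the second index.\<close>

lemma sum_edges_ordered_pairs:
  fixes g :: "'a set \<Rightarrow> real"
  assumes "finite P" "\<And>x y. (x, y) \<in> P \<Longrightarrow> x \<noteq> y \<and> (y, x) \<in> P"
  shows "(\<Sum>(x, y)\<in>P. g {x, y}) = 2 * (\<Sum>e\<in>(\<lambda>(x, y). {x, y}) ` P. g e)"
proof -
  have "(\<Sum>(x, y)\<in>P. g {x, y}) =
      (\<Sum>e\<in>(\<lambda>(x, y). {x, y}) ` P. \<Sum>q\<in>{q \<in> P. (case q of (x, y) \<Rightarrow> {x, y}) = e}. case q of (x, y) \<Rightarrow> g {x, y})"
    using assms(1) by (rule sum.image_gen)
  also have "\<dots> = (\<Sum>e\<in>(\<lambda>(x, y). {x, y}) ` P. 2 * g e)"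
  proof (intro sum.cong refl)
    fix e assume "e \<in> (\<lambda>(x, y). {x, y}) ` P"
    then obtain x y where xy: "(x, y) \<in> P" "e = {x, y}" by auto
    then have "{q \<in> P. (case q of (x, y) \<Rightarrow> {x, y}) = e} = {(x, y), (y, x)}"
      using assms(2)[OF xy(1)] by (auto simp: doubleton_eq_iff)
    moreover have "(x, y) \<noteq> (y, x)" using assms(2)[OF xy(1)] by auto
    ultimately show "(\<Sum>q\<in>{q \<in> P. (case q of (x, y) \<Rightarrow> {x, y}) = e}. case q of (x, y) \<Rightarrow> g {x, y}) = 2 * g e"
      using xy by (simp add: insert_commute)
  qed
  finally show ?thesis by (simp add: sum_distrib_left)
qed

text \<open>An edge at \<open>v\<close> is determined by its other endpoint, so the degree counts
  the coprime divisors other than \<open>v\<close>. Removing \<open>v\<close> from them changes the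
  count only for \<open>v = 1\<close>.\<close>

lemma degree_divisor_prime_graph:
  assumes "n > 0" "v dvd n"
  shows "real (degree (divisor_prime_graph n) v) = coprime_count n v - of_bool (v = 1)"
proof -
  let ?C = "{y. y dvd n \<and> coprime v y}"
  have "{e \<in> edges (divisor_prime_graph n). v \<in> e} = (\<lambda>y. {v, y}) ` (?C - {v})"
    using assms(2)
    by (auto simp: divisor_prime_graph_def coprime_iff_gcd_eq_1 gcd.commute insert_commute)
  moreover have "inj_on (\<lambda>y. {v, y}) (?C - {v})"
    by (auto simp: inj_on_def doubleton_eq_iff)
  ultimately have deg: "degree (divisor_prime_graph n) v = card (?C - {v})"
    by (simp add: degree_def card_image)
  have fin: "finite ?C" using assms(1) by simp
  show ?thesis
  proof (cases "v = 1")
    case True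
    then have "v \<in> ?C" by simp
    then have "card ?C = Suc (card (?C - {v}))"
      using fin by (metis card.remove)
    then show ?thesis using True deg assms(1) by (simp add: coprime_count_eq_card)
  next
    case False
    then have "?C - {v} = ?C" by auto
    then show ?thesis using False deg assms(1) by (simp add: coprime_count_eq_card)
  qed
qed

lemma first_zagreb_divisor_prime_graph:
  assumes "n > 0"
  shows "real (first_zagreb (divisor_prime_graph n)) =
    (\<Sum>d | d dvd n. (coprime_count n d)\<^sup>2) - 2 * real (card {d. d dvd n}) + 1"
proof -
  have "real (first_zagreb (divisor_prime_graph n)) =
      (\<Sum>d | d dvd n. (real (degree (divisor_prime_graph n) d))\<^sup>2)"
    by (simp add: first_zagreb_def divisor_prime_graph_def)
  \<comment> \<open>Expanding the square at \<open>d = 1\<close> gives the correction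
    \<open>2c - 1\<close> with \<open>c = coprime_count n 1\<close>, the number of divisors.\<close>
  also have "\<dots> = (\<Sum>d | d dvd n. (coprime_count n d)\<^sup>2 -
      (if d = 1 then 2 * coprime_count n 1 - 1 else 0))"
    using assms
    by (intro sum.cong refl) (auto simp: degree_divisor_prime_graph power2_eq_square algebra_simps)
  also have "\<dots> = (\<Sum>d | d dvd n. (coprime_count n d)\<^sup>2) - (2 * coprime_count n 1 - 1)"
    using assms by (simp add: sum_subtractf sum.delta)
  finally show ?thesis by (simp add: coprime_count_1[simplified])
qed

lemma second_zagreb_divisor_prime_graph:
  assumes "n > 0"
  shows "2 * real (second_zagreb (divisor_prime_graph n)) =
    coprime_pair_sum n - 2 * (\<Sum>d | d dvd n. coprime_count n d)
      - (real (card {d. d dvd n}))\<^sup>2 + 2 * real (card {d. d dvd n})"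
proof -
  define V where "V = {d. d dvd n}"
  define P where "P = {(x, y) \<in> V \<times> V. x \<noteq> y \<and> coprime x y}"
  define deg where "deg v = real (degree (divisor_prime_graph n) v)" for v
  let ?c = "coprime_count n"
  have fin: "finite V" and one: "1 \<in> V" using assms by (simp_all add: V_def)
  have finP: "finite P" using fin by (auto simp: P_def intro: finite_subset[of _ "V \<times> V"])
  have deg: "deg v = ?c v - of_bool (v = 1)" if "v \<in> V" for v
    using that degree_divisor_prime_graph[OF assms] by (simp add: deg_def V_def)
  have E: "edges (divisor_prime_graph n) = (\<lambda>(x, y). {x, y}) ` P"
    by (auto simp: divisor_prime_graph_def P_def V_def coprime_iff_gcd_eq_1 image_iff)
  have "2 * real (second_zagreb (divisor_prime_graph n)) =
      2 * (\<Sum>e\<in>(\<lambda>(x, y). {x, y}) ` P. \<Prod>v\<in>e. deg v)"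
    by (simp add: second_zagreb_def E deg_def)
  also have "\<dots> = (\<Sum>(x, y)\<in>P. \<Prod>v\<in>{x, y}. deg v)"
    by (rule sum_edges_ordered_pairs[symmetric])
       (use finP in \<open>auto simp: P_def coprime_commute\<close>)
  also have "\<dots> = (\<Sum>(x, y)\<in>P. deg x * deg y)"
    by (intro sum.cong refl) (auto simp: P_def)
  \<comment> \<open>Adding the only coprime pair on the diagonal turns \<open>P\<close> into the set
    of all coprime ordered pairs.\<close>
  also have "\<dots> = (\<Sum>(x, y)\<in>P \<union> {(1, 1)}. deg x * deg y) - (deg 1)\<^sup>2"
    using finP by (subst sum.union_disjoint) (auto simp: P_def power2_eq_square)
  also have "P \<union> {(1, 1)} = {q \<in> V \<times> V. coprime (fst q) (snd q)}"
    using one by (auto simp: P_def)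
  also have "(\<Sum>(x, y)\<in>\<dots>. deg x * deg y) =
      (\<Sum>(x, y)\<in>V \<times> V. of_bool (coprime x y) * (deg x * deg y))"
    using fin by (subst sum.inter_filter) (auto intro!: sum.cong)
  also have "\<dots> = (\<Sum>x\<in>V. \<Sum>y\<in>V. of_bool (coprime x y) * (deg x * deg y))"
    by (simp add: sum.cartesian_product)
  \<comment> \<open>Expand \<open>(?c x - [x = 1]) * (?c y - [y = 1])\<close>. The correction terms
    carry no coprimality indicator, since 1 is coprime to everything.\<close>
  also have "\<dots> = (\<Sum>x\<in>V. \<Sum>y\<in>V. of_bool (coprime x y) * (?c x * ?c y)
      - (if x = 1 then ?c y else 0) - (if y = 1 then ?c x else 0)
      + (if x = 1 then if y = 1 then 1 else 0 else 0))"
    by (intro sum.cong refl) (auto simp: deg algebra_simps)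
  also have "\<dots> = coprime_pair_sum n - 2 * (\<Sum>d\<in>V. ?c d) + 1"
  proof -
    have "(\<Sum>x\<in>V. \<Sum>y\<in>V. if x = 1 then ?c y else 0) = (\<Sum>d\<in>V. ?c d)"
      using fin one by (subst sum.swap) (simp add: sum.delta)
    moreover have "(\<Sum>x\<in>V. \<Sum>y\<in>V. if x = 1 then if y = 1 then 1 else 0 else 0) = (1::real)"
      using fin one by (subst sum.swap) (simp add: sum.delta)
    ultimately show ?thesis
      using fin one
      by (simp add: sum.distrib sum_subtractf sum.delta coprime_pair_sum_def V_def)
  qed
  \<comment> \<open>The vertex 1 is adjacent to all others. With \<open>D = card V\<close>, the
    constant \<open>1 - (D - 1)\<^sup>2\<close> becomes \<open>2D - D\<^sup>2\<close>.\<close>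
  also have "(deg 1)\<^sup>2 = (real (card V) - 1)\<^sup>2"
    using deg[OF one] by (simp add: coprime_count_1[simplified] V_def)
  finally show ?thesis
    by (simp add: V_def power2_eq_square algebra_simps)
qed

theorem theorem3p4:
  fixes n r D :: nat and p k :: "nat \<Rightarrow> nat"
  assumes "\<And>i. i \<in> {1..r} \<Longrightarrow> prime (p i)"
    and "inj_on p {1..r}"
    and "\<And>i. i \<in> {1..r} \<Longrightarrow> k i \<ge> 1"
    and "n = (\<Prod>i = 1..r. p i ^ k i)"
    and "D = (\<Prod>i = 1..r. (k i + 1))"
  shows "real (first_zagreb (divisor_prime_graph n)) =
           (\<Prod>i = 1..r. ((real (k i) + 1)\<^sup>2 + real (k i))) - 2 * real D + 1
       \<and> real (second_zagreb (divisor_prime_graph n)) =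
           1 / 2 * (real D * (\<Prod>i = 1..r. (3 * real (k i) + 1))
                    - 2 * (\<Prod>i = 1..r. (2 * real (k i) + 1))
                    - (real D)\<^sup>2 + 2 * real D)"
proof -
  have "n > 0"
    using assms(1) prime_gt_0_nat by (auto simp: assms(4) intro!: prod_pos)
  note prod_eq = multiplicative_prod_prime_powers[OF _ _ finite_atLeastAtMost assms(2,1),
      of _ k, folded assms(4)]
  have count_1: "coprime_count (Suc 0) (Suc 0) = 1"
    by (simp add: coprime_count_def)
  have power_sum: "(\<Sum>d | d dvd n. coprime_count n d ^ m) =
      (\<Prod>i = 1..r. (real (k i) + 1) ^ m + real (k i))" for m
    using assms(1)
    by (subst prod_eq[where F = "\<lambda>n. \<Sum>d | d dvd n. coprime_count n d ^ m"])
       (auto simp: sum_coprime_count_power_mult sum_coprime_count_power_prime_power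
         count_1 intro!: prod.cong)
  have pair_sum_1: "coprime_pair_sum (Suc 0) = 1"
    by (simp add: coprime_pair_sum_def count_1)
  have pair_sum: "coprime_pair_sum n = (\<Prod>i = 1..r. (real (k i) + 1) * (3 * real (k i) + 1))"
    using assms(1)
    by (subst prod_eq[where F = coprime_pair_sum])
       (auto simp: coprime_pair_sum_mult coprime_pair_sum_prime_power
         pair_sum_1 intro!: prod.cong)
  have D: "real D = (\<Prod>i = 1..r. real (k i) + 1)"
    by (simp add: assms(5) add.commute)
  \<comment> \<open>At \<open>m = 0\<close> every summand is 1 and the factor of \<open>i\<close> is
    \<open>1 + k i\<close>.\<close>
  have card: "real (card {d. d dvd n}) = real D"
    using power_sum[of 0] by (simp add: D add.commute)
  have "(\<Sum>d | d dvd n. coprime_count n d) = (\<Prod>i = 1..r. 2 * real (k i) + 1)"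
    using power_sum[of 1] by (simp add: algebra_simps)
  moreover have "coprime_pair_sum n = real D * (\<Prod>i = 1..r. 3 * real (k i) + 1)"
    by (simp add: pair_sum D prod.distrib)
  ultimately show ?thesis
    using first_zagreb_divisor_prime_graph[OF \<open>n > 0\<close>]
      second_zagreb_divisor_prime_graph[OF \<open>n > 0\<close>]
    by (simp add: power_sum card)
qed

end
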